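(* Let $(C,\leq)$ be a chain with at least $3$ elements such that $0$ is the smallest and $1$ is the greatest element of $C$. Then $(C,\max,\min)$ (with addition $\max$, multiplication $\min$, zero $0$ and one $1$) is not a classical semiring, though each element of $C$ is either a unit or multiplicatively non-cancellative.
   Context: A semiring is an algebraic structure $(S,+,\cdot,0,1)$ such that $(S,+,0)$ and $(S,\cdot,1)$ are commutative monoids, multiplication distributes over addition, and $s\cdot 0=0$ for all $s\in S$. A chain is a totally ordered set. An element $s\in S$ is a unit if $st=1$ for some $t\in S$; it is a zero-divisor if $sx=0$ for some nonzero $x\in S$; it is multiplicatively cancellative if $sx_1=sx_2$ implies $x_1=x_2$ for all $x_1,x_2\in S$, and multiplicatively non-cancellative otherwise. A semiring is classical if each of its elements is either a unit or a zero-divisor. *)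

theory Defs
  imports "HOL-Algebra.Ring" "HOL-Algebra.Order"
begin

text \<open>The library locale \<^locale>\<open>semiring\<close> does not require the multiplication to be commutative.
  As in \<^locale>\<open>semiring\<close>, zero and one are allowed to coincide.\<close>

locale commutative_semiring = semiring S + comm_monoid S for S (structure)

definition zero_divisor :: "('a, 'm) ring_scheme \<Rightarrow> 'a \<Rightarrow> bool"
  where "zero_divisor S s \<longleftrightarrow> s \<in> carrier S \<and>
    (\<exists>x \<in> carrier S. x \<noteq> \<zero>\<^bsub>S\<^esub> \<and> s \<otimes>\<^bsub>S\<^esub> x = \<zero>\<^bsub>S\<^esub>)"

definition mult_cancellative :: "('a, 'm) ring_scheme \<Rightarrow> 'a \<Rightarrow> bool"
  where "mult_cancellative S s \<longleftrightarrow> s \<in> carrier S \<and>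
    (\<forall>x\<^sub>1 \<in> carrier S. \<forall>x\<^sub>2 \<in> carrier S. s \<otimes>\<^bsub>S\<^esub> x\<^sub>1 = s \<otimes>\<^bsub>S\<^esub> x\<^sub>2 \<longrightarrow> x\<^sub>1 = x\<^sub>2)"

locale classical_semiring = commutative_semiring +
  assumes unit_or_zero_divisor: "s \<in> carrier S \<Longrightarrow> s \<in> Units S \<or> zero_divisor S s"

text \<open>Here \<^term>\<open>ord.max (le L)\<close> and \<^term>\<open>ord.min (le L)\<close> are the library's maximum and minimum,
  taken with respect to the order of \<open>L\<close> instead of the order of a type class.\<close>

definition max_min_structure :: "('a, 'm) gorder_scheme \<Rightarrow> 'a \<Rightarrow> 'a \<Rightarrow> 'a ring"
  where "max_min_structure L z u =
    \<lparr>carrier = carrier L, mult = ord.min (le L), one = u, zero = z, add = ord.max (le L)\<rparr>"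

end

theory Submission
  imports Defs
begin

text \<open>In a chain, minimum and maximum only ever return one of their two arguments. All three claims
  rest on this. The semiring laws reduce to a comparison of the elements involved. A minimum
  is the greatest element \<open>u\<close> only if both arguments are, so \<open>u\<close> is the only unit; and a minimum is
  the smallest element \<open>z\<close> only if one argument is, so no element other than \<open>z\<close> is a zero-divisor.
  Any third element is therefore neither, which is where at least three elements are needed.
  Finally, multiplication is idempotent: \<open>s\<close> has equal products with \<open>s\<close> and with \<open>u\<close>, so
  cancellativity would force \<open>s\<close> to be the unit \<open>u\<close>.\<close>

lemma max_min_structure_simps [simp]:
  "carrier (max_min_structure L z u) = carrier L"
  "mult (max_min_structure L z u) = ord.min (le L)"
  "one (max_min_structure L z u) = u"
  "zero (max_min_structure L z u) = z"
  "add (max_min_structure L z u) = ord.max (le L)"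
  by (simp_all add: max_min_structure_def)

lemma max_min_zero_divisor_eq_zero:
  assumes "zero_divisor (max_min_structure L z u) s"
  shows "s = z"
  using assms by (auto simp: zero_divisor_def ord.min_def split: if_splits)

context total_order
begin

lemma max_min_commutative_semiring:
  assumes z: "least L z (carrier L)" and u: "greatest L u (carrier L)"
  shows "commutative_semiring (max_min_structure L z u)"
proof -
  note bounds = least_closed[OF z] least_le[OF z] greatest_closed[OF u] greatest_le[OF u]
  note order = le_antisym le_trans total_order_total
  let ?S = "max_min_structure L z u"
  have "comm_monoid (add_monoid ?S)"
    by (rule comm_monoidI) (auto simp: ord.max_def bounds; metis order bounds)+
  moreover have "comm_monoid ?S"
    by (rule comm_monoidI) (auto simp: ord.min_def bounds; metis order bounds)+
  moreover have "semiring_axioms ?S"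
    by unfold_locales
      (auto simp: ord.max_def ord.min_def bounds; metis order bounds)+
  ultimately show ?thesis
    by (simp add: commutative_semiring_def semiring_def abelian_monoid_def comm_monoid.axioms(1))
qed

lemma max_min_Units:
  assumes u: "greatest L u (carrier L)"
  shows "Units (max_min_structure L z u) = {u}"
  using greatest_closed[OF u] greatest_le[OF u]
  by (auto simp: Units_def ord.min_def split: if_splits intro: le_antisym)

text \<open>Since \<open>s\<close> is idempotent, cancelling it in \<open>s \<cdot> s = s = s \<cdot> u\<close> gives \<open>s = u\<close>.\<close>

lemma max_min_cancellative_eq_one:
  assumes u: "greatest L u (carrier L)"
    and s: "mult_cancellative (max_min_structure L z u) s"
  shows "s = u"
proof -
  have "s \<in> carrier L"
    using s by (simp add: mult_cancellative_def)
  moreover from this have "ord.min (le L) s s = ord.min (le L) s u"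
    using greatest_le[OF u] by (simp add: ord.min_def)
  ultimately show ?thesis
    using s greatest_closed[OF u] by (simp add: mult_cancellative_def)
qed

end

theorem proposition3p3:
  fixes C :: "('a, 'm) gorder_scheme" and z u :: 'a
  assumes chain: "total_order C"
    and three: "infinite (carrier C) \<or> card (carrier C) \<ge> 3"
    and smallest: "least C z (carrier C)"
    and greatest: "greatest C u (carrier C)"
  shows "commutative_semiring (max_min_structure C z u)
    \<and> \<not> classical_semiring (max_min_structure C z u)
    \<and> (\<forall>s \<in> carrier C. s \<in> Units (max_min_structure C z u)
         \<or> \<not> mult_cancellative (max_min_structure C z u) s)"
proof -
  interpret total_order C by (fact chain)
  let ?S = "max_min_structure C z u"
  have "\<not> carrier C \<subseteq> {z, u}"
  proof
    assume sub: "carrier C \<subseteq> {z, u}"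
    have "card {z, u} \<le> 2"
      by (simp add: card_insert_if)
    with sub three show False
      using card_mono[OF _ sub] finite_subset[OF sub] by fastforce
  qed
  then obtain c where c: "c \<in> carrier C" "c \<noteq> z" "c \<noteq> u"
    by blast
  have "\<not> classical_semiring ?S"
  proof
    assume "classical_semiring ?S"
    then have "c \<in> Units ?S \<or> zero_divisor ?S c"
      using c(1) by (simp add: classical_semiring.unit_or_zero_divisor)
    with c show False
      by (auto simp: max_min_Units[OF greatest] dest: max_min_zero_divisor_eq_zero)
  qed
  moreover have "s \<in> Units ?S \<or> \<not> mult_cancellative ?S s" for s
    using max_min_Units[OF greatest] max_min_cancellative_eq_one[OF greatest] by blast
  ultimately show ?thesis
    using max_min_commutative_semiring[OF smallest greatest] by blast
qed

end
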